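(* The $k$-FVS problem on $n$-vertex graphs can be solved by a deterministic one-pass streaming algorithm using $O(k\cdot n)$ space in insertion-only streams and $\widetilde{O}(k\cdot n)$ space in insertion-deletion streams.
   Context: $k$-FVS: given an undirected graph $G=(V,E)$, decide whether there is a set $X\subseteq V$ with $|X|\le k$ such that $G\setminus X$ has no cycles. Streaming model: the $n$ vertices are fixed, edges arrive one by one (insertion-only: only insertions; insertion-deletion: insertions and deletions). Space is measured in words of $O(\log n)$ bits; $\widetilde{O}$ hides $\log^{O(1)} n$ factors; unbounded computation is allowed. *)

theory Defs
  imports Complex_Main
begin

text \<open>
  Undirected simple graphs: a vertex set together with a set of two-element edges.
\<close>

definition all_edges :: "'a set \<Rightarrow> 'a set set" where
  "all_edges V = {e. e \<subseteq> V \<and> card e = 2}"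

text \<open>
  A cycle is given by its sequence of pairwise distinct vertices, the first one not being
  repeated at the end.  The bound 3 excludes walking back and forth along a single edge.
\<close>

definition is_cycle :: "'a set set \<Rightarrow> 'a list \<Rightarrow> bool" where
  "is_cycle E vs \<longleftrightarrow> 3 \<le> length vs \<and> distinct vs \<and>
     (\<forall>i<length vs. {vs ! i, vs ! (Suc i mod length vs)} \<in> E)"

definition acyclic_graph :: "'a set set \<Rightarrow> bool" where
  "acyclic_graph E \<longleftrightarrow> (\<nexists>vs. is_cycle E vs)"

definition delete_vertices :: "'a set set \<Rightarrow> 'a set \<Rightarrow> 'a set set" where
  "delete_vertices E X = {e \<in> E. e \<inter> X = {}}"

definition has_FVS :: "nat \<Rightarrow> 'a set \<Rightarrow> 'a set set \<Rightarrow> bool" where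
  "has_FVS k V E \<longleftrightarrow> (\<exists>X\<subseteq>V. card X \<le> k \<and> acyclic_graph (delete_vertices E X))"

datatype 'e update = Insert 'e | Delete 'e

fun apply_update :: "'e set \<Rightarrow> 'e update \<Rightarrow> 'e set" where
  "apply_update E (Insert e) = insert e E"
| "apply_update E (Delete e) = E - {e}"

definition stream_graph :: "'e update list \<Rightarrow> 'e set" where
  "stream_graph us = foldl apply_update {} us"

text \<open>
  The streamed graph is simple at all times: only absent edges are inserted and only
  present edges are deleted.
\<close>

fun valid_update :: "'a set \<Rightarrow> 'a set set \<Rightarrow> 'a set update \<Rightarrow> bool" where
  "valid_update V E (Insert e) \<longleftrightarrow> e \<in> all_edges V \<and> e \<notin> E"
| "valid_update V E (Delete e) \<longleftrightarrow> e \<in> E"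

text \<open>The vertices of an \<open>n\<close>-vertex graph are \<open>0, \<dots>, n - 1\<close>.\<close>

definition insertion_deletion_streams :: "nat \<Rightarrow> nat set update list set" where
  "insertion_deletion_streams n =
     {us. \<forall>i<length us. valid_update {..<n} (stream_graph (take i us)) (us ! i)}"

definition insertion_only_streams :: "nat \<Rightarrow> nat set update list set" where
  "insertion_only_streams n = {us \<in> insertion_deletion_streams n. \<forall>e. Delete e \<notin> set us}"

text \<open>
  A deterministic one-pass streaming algorithm.  All that it retains between two updates is
  the content of its memory, a list of words.  Computation is unbounded, so the processing of
  an update and the final decision are arbitrary functions of the memory (and the update).
\<close>

record 'u streaming_algorithm =
  init :: "nat list"
  step :: "nat list \<Rightarrow> 'u \<Rightarrow> nat list"
  decision :: "nat list \<Rightarrow> bool"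

definition memory :: "'u streaming_algorithm \<Rightarrow> 'u list \<Rightarrow> nat list" where
  "memory A us = foldl (step A) (init A) us"

text \<open>
  An algorithm for the parameterized problem is a family indexed by the number \<open>n\<close> of
  vertices and the parameter \<open>k\<close>, both of which are known in advance.
\<close>

type_synonym graph_algorithm = "nat \<Rightarrow> nat \<Rightarrow> nat set update streaming_algorithm"

definition solves_FVS :: "graph_algorithm \<Rightarrow> (nat \<Rightarrow> nat set update list set) \<Rightarrow> bool" where
  "solves_FVS A streams \<longleftrightarrow>
     (\<forall>n k. \<forall>us\<in>streams n.
        decision (A n k) (memory (A n k) us) \<longleftrightarrow> has_FVS k {..<n} (stream_graph us))"

text \<open>
  Space is counted in words of \<open>b * \<lceil>log 2 n\<rceil>\<close> bits, for a constant \<open>b\<close>.  Both stream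
  models are closed under prefixes, so every memory content occurring during a run is covered.
  The bound concerns \<open>n \<ge> 2\<close> and \<open>k \<ge> 1\<close>: otherwise \<open>log n\<close> or \<open>k * n\<close> vanishes.
\<close>

definition uses_space ::
  "graph_algorithm \<Rightarrow> (nat \<Rightarrow> nat set update list set) \<Rightarrow> (nat \<Rightarrow> nat \<Rightarrow> real) \<Rightarrow> bool" where
  "uses_space A streams s \<longleftrightarrow>
     (\<exists>b::nat. \<forall>n\<ge>2. \<forall>k\<ge>1. \<forall>us\<in>streams n.
        real (length (memory (A n k) us)) \<le> s n k \<and>
        (\<forall>w\<in>set (memory (A n k) us). w < 2 ^ (b * nat \<lceil>log 2 (real n)\<rceil>)))"

end

theory Submission
  imports Defs
begin

text \<open>
  A graph on \<open>n\<close> vertices with a feedback vertex set of size \<open>k\<close> has at most \<open>(k + 1) * n\<close> edges: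
  at most \<open>k * n\<close> edges meet the feedback vertex set, and the remaining ones form a forest.  In an
  insertion-only stream one therefore stores all edges, and stops once there are too many of them.

  With deletions, the graph may be dense in the meantime.  One keeps the number of edges and the sum
  over the finite field with two elements of vectors attached to the edges, where every
  \<open>2 * (k + 1) * n\<close> of these vectors are linearly independent.  Two graphs with at most
  \<open>(k + 1) * n\<close> edges and the same sum then coincide, so that a sparse final graph can be recovered.
  As in the Gilbert-Varshamov bound, a greedy choice yields such vectors of dimension
  \<open>O(k * n * log n)\<close>.
\<close>

section \<open>Edge counts\<close>

lemma all_edges_subset_image:
  "all_edges V \<subseteq> (\<lambda>(u, v). {u, v}) ` (V \<times> V)"
proof
  fix e assume "e \<in> all_edges V"
  then obtain u v where "e = {u, v}" "u \<in> V" "v \<in> V"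
    by (auto simp: all_edges_def card_2_iff)
  then show "e \<in> (\<lambda>(u, v). {u, v}) ` (V \<times> V)" by auto
qed

lemma finite_all_edges: "finite V \<Longrightarrow> finite (all_edges V)"
  by (rule finite_subset[OF all_edges_subset_image]) auto

lemma card_all_edges_le:
  assumes "finite V"
  shows "card (all_edges V) \<le> card V * card V"
proof -
  have "card (all_edges V) \<le> card ((\<lambda>(u, v). {u, v}) ` (V \<times> V))"
    using assms by (intro card_mono all_edges_subset_image) auto
  also have "\<dots> \<le> card (V \<times> V)" using assms by (intro card_image_le) auto
  finally show ?thesis by (simp add: card_cartesian_product)
qed

section \<open>Cycles in graphs of minimum degree two\<close>

lemma is_cycle_if_back_edge:
  assumes path: "successively (\<lambda>u v. {u, v} \<in> E) vs" and "distinct vs"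
    and j: "2 \<le> j" "j < length vs" and closing: "{vs ! 0, vs ! j} \<in> E"
  shows "is_cycle E (take (Suc j) vs)"
proof -
  have len: "length (take (Suc j) vs) = Suc j" using j by simp
  have "{take (Suc j) vs ! i, take (Suc j) vs ! (Suc i mod Suc j)} \<in> E" if "i < Suc j" for i
  proof (cases "i = j")
    case True
    then show ?thesis using closing by (simp add: insert_commute)
  next
    case False
    then have "Suc i < Suc j" using that by simp
    then show ?thesis using path j by (simp add: successively_conv_nth)
  qed
  then show ?thesis
    unfolding is_cycle_def len using j \<open>distinct vs\<close> by simp
qed

text \<open>Take a longest path. All neighbours of its first vertex lie on it, and one of them is
  not the second vertex; the edge to that one closes a cycle.\<close>

lemma ex_cycle_if_min_degree_2:
  assumes V: "finite V" "V \<noteq> {}" and E: "E \<subseteq> all_edges V"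
    and deg: "\<And>v. v \<in> V \<Longrightarrow> 2 \<le> card {e \<in> E. v \<in> e}"
  shows "\<exists>vs. is_cycle E vs"
proof -
  define P where "P = (\<lambda>vs. vs \<noteq> [] \<and> distinct vs \<and> set vs \<subseteq> V \<and>
    successively (\<lambda>u v. {u, v} \<in> E) vs)"
  obtain v0 where "v0 \<in> V" using V by auto
  then have "P [v0]" by (simp add: P_def)
  moreover have "\<forall>vs. P vs \<longrightarrow> length vs < Suc (card V)"
    using V by (auto simp: P_def less_Suc_eq_le distinct_card[symmetric] intro!: card_mono)
  ultimately obtain vs where vs: "P vs" and max: "\<And>ws. P ws \<Longrightarrow> length ws \<le> length vs"
    using ex_has_greatest_nat[of P "[v0]" length "Suc (card V)"] by metis
  obtain v ws where vs_eq: "vs = v # ws" using vs by (cases vs) (auto simp: P_def)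
  have "v \<in> V" using vs by (simp add: P_def vs_eq)
  \<comment> \<open>For a one-vertex path \<open>hd ws\<close> is unspecified, which is harmless:
    one set cannot account for two edges at \<open>v\<close>.\<close>
  have "\<not> {e \<in> E. v \<in> e} \<subseteq> {{v, hd ws}}"
  proof
    assume "{e \<in> E. v \<in> e} \<subseteq> {{v, hd ws}}"
    from card_mono[OF _ this] show False using deg[OF \<open>v \<in> V\<close>] by simp
  qed
  then obtain e where e: "e \<in> E" "v \<in> e" "e \<noteq> {v, hd ws}" by auto
  then have "e \<subseteq> V" "card e = 2" using E by (auto simp: all_edges_def)
  then obtain u where u: "e = {v, u}" "u \<noteq> v" "u \<in> V"
    using e(2) by (auto simp: card_2_iff)
  have "u \<in> set vs"
  proof (rule ccontr)
    assume "u \<notin> set vs"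
    then have "P (u # vs)" using vs u e(1)
      by (simp add: P_def vs_eq insert_commute)
    from max[OF this] show False by simp
  qed
  then obtain j where j: "j < length vs" "vs ! j = u" by (auto simp: in_set_conv_nth)
  have "j \<noteq> 0" using j u by (intro notI) (simp add: vs_eq)
  moreover have "j \<noteq> 1"
    using j u e(3) by (cases ws) (auto simp: vs_eq)
  ultimately have "2 \<le> j" by simp
  then have "is_cycle E (take (Suc j) vs)"
    using vs j u e(1) by (intro is_cycle_if_back_edge) (auto simp: P_def vs_eq)
  then show ?thesis by blast
qed

section \<open>Edge bounds for forests and for graphs with a small feedback vertex set\<close>

lemma acyclic_graph_mono: "acyclic_graph E \<Longrightarrow> F \<subseteq> E \<Longrightarrow> acyclic_graph F"
  by (meson acyclic_graph_def is_cycle_def subsetD)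

text \<open>Induction on the number of vertices: some vertex has degree at most one, so deleting it
  costs at most one edge.\<close>

lemma card_acyclic_graph_le:
  assumes "finite V" "E \<subseteq> all_edges V" "acyclic_graph E"
  shows "card E \<le> card V"
  using assms
proof (induction "card V" arbitrary: V E)
  case 0
  then have "E = {}" by (auto simp: all_edges_def)
  then show ?case by simp
next
  case (Suc m)
  then have "V \<noteq> {}" by auto
  then obtain v where v: "v \<in> V" "\<not> 2 \<le> card {e \<in> E. v \<in> e}"
    using ex_cycle_if_min_degree_2[of V E] Suc.prems by (auto simp: acyclic_graph_def)
  have fin: "finite E" using Suc.prems finite_all_edges finite_subset by blast
  let ?F = "{e \<in> E. v \<notin> e}"
  have "card ?F \<le> card (V - {v})"
    using Suc.prems Suc.hyps(2) v(1)
    by (intro Suc.hyps(1)) (auto simp: all_edges_def intro: acyclic_graph_mono)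
  moreover have "card E = card ?F + card {e \<in> E. v \<in> e}"
    using fin by (subst card_Un_disjoint[symmetric]) (auto intro!: arg_cong[of _ _ card])
  moreover have "card (V - {v}) + 1 = card V" using v(1) Suc.hyps(2) Suc.prems(1) by simp
  ultimately show ?case using v(2) by simp
qed

lemma card_le_if_has_FVS:
  assumes V: "finite V" and E: "E \<subseteq> all_edges V" and fvs: "has_FVS k V E"
  shows "card E \<le> (k + 1) * card V"
proof -
  obtain X where X: "X \<subseteq> V" "card X \<le> k" "acyclic_graph (delete_vertices E X)"
    using fvs by (auto simp: has_FVS_def)
  \<comment> \<open>\<open>?S\<close> may also contain singletons and non-edges; only its size
    matters.\<close>
  let ?S = "(\<lambda>(x, v). {x, v}) ` (X \<times> V)"
  have fin: "finite X" using X V finite_subset by blast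
  have "E \<subseteq> delete_vertices E X \<union> ?S"
  proof
    fix e assume e: "e \<in> E"
    show "e \<in> delete_vertices E X \<union> ?S"
    proof (cases "e \<inter> X = {}")
      case True
      then show ?thesis using e by (simp add: delete_vertices_def)
    next
      case False
      then obtain x where x: "x \<in> e" "x \<in> X" by auto
      have "e \<subseteq> V" "card e = 2" using e E by (auto simp: all_edges_def)
      then obtain v where "e = {x, v}" "v \<in> V" using x(1) by (auto simp: card_2_iff)
      then show ?thesis using x by auto
    qed
  qed
  moreover have "finite (delete_vertices E X)"
    using finite_subset[OF E finite_all_edges[OF V]] by (simp add: delete_vertices_def)
  ultimately have "card E \<le> card (delete_vertices E X \<union> ?S)"
    using fin V by (intro card_mono) auto
  also have "\<dots> \<le> card (delete_vertices E X) + card ?S" by (rule card_Un_le)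
  also have "card (delete_vertices E X) \<le> card V"
    using E X V by (intro card_acyclic_graph_le) (auto simp: delete_vertices_def)
  also have "card ?S \<le> card (X \<times> V)" using fin V by (intro card_image_le) auto
  also have "\<dots> \<le> k * card V" using X by (simp add: card_cartesian_product)
  finally show ?thesis by simp
qed

section \<open>Streams\<close>

lemma stream_graph_snoc: "stream_graph (us @ [u]) = apply_update (stream_graph us) u"
  by (simp add: stream_graph_def)

lemma memory_snoc: "memory A (us @ [u]) = step A (memory A us) u"
  by (simp add: memory_def)

lemma insertion_deletion_streams_snoc:
  "us @ [u] \<in> insertion_deletion_streams n \<longleftrightarrow>
     us \<in> insertion_deletion_streams n \<and> valid_update {..<n} (stream_graph us) u"
  by (auto simp: insertion_deletion_streams_def nth_append less_Suc_eq)

lemma stream_graph_subset: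
  "us \<in> insertion_deletion_streams n \<Longrightarrow> stream_graph us \<subseteq> all_edges {..<n}"
proof (induction us rule: rev_induct)
  case Nil
  then show ?case by (simp add: stream_graph_def)
next
  case (snoc u us)
  then show ?case
    by (cases u) (auto simp: insertion_deletion_streams_snoc stream_graph_snoc)
qed

lemma finite_stream_graph:
  "us \<in> insertion_deletion_streams n \<Longrightarrow> finite (stream_graph us)"
  by (rule finite_subset[OF stream_graph_subset finite_all_edges]) simp_all

section \<open>Powers of two for the word size\<close>

lemma le_two_power_log: "n \<le> 2 ^ nat \<lceil>log 2 (real n)\<rceil>"
proof (cases "n = 0")
  case False
  have "log 2 (real n) \<le> real (nat \<lceil>log 2 (real n)\<rceil>)" by (rule real_nat_ceiling_ge)
  then have "real n \<le> 2 powr real (nat \<lceil>log 2 (real n)\<rceil>)"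
    using False by (subst (asm) log_le_iff) simp_all
  then have "real n \<le> real (2 ^ nat \<lceil>log 2 (real n)\<rceil>)" by (simp add: powr_realpow)
  then show ?thesis by (simp only: of_nat_le_iff)
qed simp

text \<open>Edge codes and edge counts are bounded by \<open>n * n\<close>; this turns that bound
  into a number of bits.\<close>

lemma square_le_two_power_log: "n * n \<le> 2 ^ (2 * nat \<lceil>log 2 (real n)\<rceil>)"
  using mult_mono[OF le_two_power_log le_two_power_log, of n n]
  by (simp add: mult_2 power_add)

section \<open>Insertion-only streams\<close>

text \<open>The endpoints are the two digits of a number in base \<open>n\<close>. As an edge is
  unordered, \<open>Min\<close> and \<open>Max\<close> fix the order of the digits.\<close>

definition edge_code :: "nat \<Rightarrow> nat set \<Rightarrow> nat" where
  "edge_code n e = Min e * n + Max e"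

definition edge_decode :: "nat \<Rightarrow> nat \<Rightarrow> nat set" where
  "edge_decode n w = {w div n, w mod n}"

lemma edge_code:
  assumes "e \<in> all_edges {..<n}"
  shows "edge_decode n (edge_code n e) = e" "edge_code n e < n * n"
proof -
  obtain u v where e: "e = {u, v}" "u < n" "v < n"
    using assms by (auto simp: all_edges_def card_2_iff)
  then show "edge_decode n (edge_code n e) = e"
    by (auto simp: edge_decode_def edge_code_def min_def max_def)
  have "Min e * n + Max e < (Min e + 1) * n" using e by simp
  also have "\<dots> \<le> n * n" using e by (intro mult_right_mono) auto
  finally show "edge_code n e < n * n" by (simp add: edge_code_def)
qed

text \<open>A memory of \<open>(k + 1) * n + 1\<close> words signals an overflow.\<close>

definition store_edges :: graph_algorithm where
  "store_edges n k =
    \<lparr>init = [],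
     step = (\<lambda>m u. case u of
         Insert e \<Rightarrow> if length m \<le> (k + 1) * n then edge_code n e # m else m
       | Delete e \<Rightarrow> m),
     decision = (\<lambda>m. length m \<le> (k + 1) * n \<and> has_FVS k {..<n} (edge_decode n ` set m))\<rparr>"

lemma step_store_edges:
  "step (store_edges n k) m (Insert e) =
     (if length m \<le> (k + 1) * n then edge_code n e # m else m)"
  by (simp add: store_edges_def)

lemma decision_store_edges:
  "decision (store_edges n k) m \<longleftrightarrow>
     length m \<le> (k + 1) * n \<and> has_FVS k {..<n} (edge_decode n ` set m)"
  by (simp add: store_edges_def)

text \<open>The length tells whether an overflow has occurred; without one, every edge has been
  stored. After an overflow the memory stays frozen, hence the \<open>min\<close>.\<close>

lemma memory_store_edges:
  assumes "us \<in> insertion_only_streams n"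
  shows "length (memory (store_edges n k) us) = min (card (stream_graph us)) ((k + 1) * n + 1)"
    and "set (memory (store_edges n k) us) \<subseteq> {..<n * n}"
    and "card (stream_graph us) \<le> (k + 1) * n \<Longrightarrow>
      edge_decode n ` set (memory (store_edges n k) us) = stream_graph us"
  using assms
proof (induction us rule: rev_induct)
  case Nil
  {
    case 1
    show ?case by (simp add: memory_def store_edges_def stream_graph_def)
  next
    case 2
    show ?case by (simp add: memory_def store_edges_def)
  next
    case 3
    show ?case by (simp add: memory_def store_edges_def stream_graph_def)
  }
next
  case (snoc u us)
  \<comment> \<open>Validity makes every update bring a new edge, so the length of the stored list
    counts edges without repetition.\<close>
  have *: "us \<in> insertion_only_streams n \<and> (\<exists>e. u = Insert e \<and> e \<in> all_edges {..<n} \<and>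
      e \<notin> stream_graph us \<and> card (insert e (stream_graph us)) = Suc (card (stream_graph us)))"
    if "us @ [u] \<in> insertion_only_streams n"
    using that finite_stream_graph[of us n]
    by (cases u) (auto simp: insertion_only_streams_def insertion_deletion_streams_snoc)
  {
    case 1
    from *[OF 1] snoc(1) show ?case
      by (auto simp: memory_snoc stream_graph_snoc step_store_edges split: if_splits)
  next
    case 2
    from *[OF 2] snoc(2) edge_code(2) show ?case
      by (auto simp: memory_snoc stream_graph_snoc step_store_edges split: if_splits)
  next
    case 3
    from *[OF 3(2)] snoc(1,3) 3(1) edge_code(1) show ?case
      by (clarsimp simp: memory_snoc stream_graph_snoc step_store_edges)
  }
qed

lemma solves_FVS_store_edges: "solves_FVS store_edges insertion_only_streams"
  unfolding solves_FVS_def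
proof (intro allI ballI)
  fix n k us assume us: "us \<in> insertion_only_streams n"
  let ?m = "memory (store_edges n k) us" and ?E = "stream_graph us"
  have sub: "?E \<subseteq> all_edges {..<n}"
    using us stream_graph_subset by (auto simp: insertion_only_streams_def)
  have "decision (store_edges n k) ?m \<longleftrightarrow>
      length ?m \<le> (k + 1) * n \<and> has_FVS k {..<n} (edge_decode n ` set ?m)"
    by (rule decision_store_edges)
  also have "\<dots> \<longleftrightarrow> card ?E \<le> (k + 1) * n \<and> has_FVS k {..<n} ?E"
    using memory_store_edges(1,3)[OF us, of k] by auto
  \<comment> \<open>By the edge bound, rejecting after an overflow is correct.\<close>
  also have "\<dots> \<longleftrightarrow> has_FVS k {..<n} ?E"
    using card_le_if_has_FVS[OF _ sub] by auto
  finally show "decision (store_edges n k) ?m \<longleftrightarrow> has_FVS k {..<n} ?E" .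
qed

lemma uses_space_store_edges:
  "uses_space store_edges insertion_only_streams (\<lambda>n k. 3 * (real k * real n))"
  unfolding uses_space_def
proof (intro exI[of _ 2] allI impI ballI conjI)
  fix n k :: nat and us
  assume nk: "2 \<le> n" "1 \<le> k" and us: "us \<in> insertion_only_streams n"
  have n_le: "n \<le> k * n" using nk by simp
  have "length (memory (store_edges n k) us) \<le> k * n + n + 1"
    unfolding memory_store_edges(1)[OF us] by simp
  \<comment> \<open>Each of the three summands is at most \<open>k * n\<close>, as
    \<open>k \<ge> 1\<close> and \<open>n \<ge> 2\<close>.\<close>
  also have "\<dots> \<le> 3 * (k * n)" using n_le nk by linarith
  finally have "length (memory (store_edges n k) us) \<le> 3 * (k * n)" .
  then have "real (length (memory (store_edges n k) us)) \<le> real (3 * (k * n))"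
    by (simp only: of_nat_le_iff)
  then show "real (length (memory (store_edges n k) us)) \<le> 3 * (real k * real n)" by simp
  fix w assume "w \<in> set (memory (store_edges n k) us)"
  then have "w < n * n" using memory_store_edges(2)[OF us] by auto
  then show "w < 2 ^ (2 * nat \<lceil>log 2 (real n)\<rceil>)"
    using square_le_two_power_log by (rule less_le_trans)
qed

section \<open>Linear sketches over the field with two elements\<close>

text \<open>Vectors over the field with two elements are represented by their supports.\<close>

definition xor_sketch :: "('a \<Rightarrow> 'b set) \<Rightarrow> 'a set \<Rightarrow> 'b set" where
  "xor_sketch h D = {i. odd (card {e \<in> D. i \<in> h e})}"

text \<open>\<open>card A + card B\<close> counts the common elements twice, which does not affect
  parity.\<close>

lemma odd_card_sym_diff:
  assumes "finite A" "finite B"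
  shows "odd (card (sym_diff A B)) \<longleftrightarrow> odd (card A) \<noteq> odd (card B)"
proof -
  have "card A = card (A - B) + card (A \<inter> B)" "card B = card (B - A) + card (A \<inter> B)"
    using assms by (subst card_Un_disjoint[symmetric]; auto intro!: arg_cong[of _ _ card])+
  moreover have "card (sym_diff A B) = card (A - B) + card (B - A)"
    using assms by (intro card_Un_disjoint) auto
  ultimately show ?thesis by presburger
qed

lemma xor_sketch_singleton: "xor_sketch h {e} = h e"
proof -
  have "{x. x = e \<and> i \<in> h x} = (if i \<in> h e then {e} else {})" for i by auto
  then show ?thesis by (auto simp: xor_sketch_def split: if_splits)
qed

text \<open>This is linearity, with symmetric difference as addition on both sides. It allows
  updates without access to the edge set and reduces injectivity to the absence of small zero
  sums.\<close>

lemma xor_sketch_sym_diff: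
  assumes "finite A" "finite B"
  shows "xor_sketch h (sym_diff A B) = sym_diff (xor_sketch h A) (xor_sketch h B)"
proof -
  have "{e \<in> sym_diff A B. i \<in> h e} = sym_diff {e \<in> A. i \<in> h e} {e \<in> B. i \<in> h e}" for i
    by auto
  then show ?thesis
    using assms by (auto simp: xor_sketch_def odd_card_sym_diff)
qed

lemma xor_sketch_cong:
  "(\<And>e. e \<in> D \<Longrightarrow> h e = g e) \<Longrightarrow> xor_sketch h D = xor_sketch g D"
proof -
  assume "\<And>e. e \<in> D \<Longrightarrow> h e = g e"
  then have "{e \<in> D. i \<in> h e} = {e \<in> D. i \<in> g e}" for i by auto
  then show ?thesis by (simp add: xor_sketch_def)
qed

text \<open>A linear relation over the two-element field is a nonempty set with zero sum. For finite
  \<open>A\<close>, the vectors are thus the columns of a parity-check matrix of a binary code with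
  minimum distance above \<open>t\<close>.\<close>

definition independent_sketch :: "('a \<Rightarrow> 'b set) \<Rightarrow> 'a set \<Rightarrow> nat \<Rightarrow> bool" where
  "independent_sketch h A t \<longleftrightarrow>
     (\<forall>D\<subseteq>A. D \<noteq> {} \<longrightarrow> card D \<le> t \<longrightarrow> xor_sketch h D \<noteq> {})"

text \<open>
  The vector of a new element only has to avoid the sums over the small sets of the elements
  treated before.
\<close>

lemma ex_independent_sketch:
  assumes "finite A" "finite I" "card {D. D \<subseteq> A \<and> card D \<le> t} < 2 ^ card I"
  shows "\<exists>h. range h \<subseteq> Pow I \<and> independent_sketch h A t"
  using assms(1,3)
proof (induction A rule: finite_induct)
  case empty
  show ?case by (intro exI[of _ "\<lambda>_. {}"]) (simp add: independent_sketch_def)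
next
  case (insert a A)
  let ?F = "{D. D \<subseteq> A \<and> card D \<le> t}"
  have fin: "finite ?F" using insert.hyps(1) by simp
  have "card ?F \<le> card {D. D \<subseteq> insert a A \<and> card D \<le> t}"
    using insert.hyps(1) by (intro card_mono) auto
  then have less: "card ?F < 2 ^ card I" using insert.prems by simp
  then obtain h where h: "range h \<subseteq> Pow I" "independent_sketch h A t"
    using insert.IH by auto
  \<comment> \<open>There are fewer sums over small sets than vectors, so some vector
    \<open>B\<close> is not such a sum.\<close>
  have "card (xor_sketch h ` ?F) < card (Pow I)"
    using card_image_le[OF fin, of "xor_sketch h"] less assms(2) by (simp add: card_Pow)
  then obtain B where B: "B \<subseteq> I" "B \<notin> xor_sketch h ` ?F"
    using card_mono[of "xor_sketch h ` ?F" "Pow I"] fin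
    by (meson PowD finite_imageI not_less subsetI)
  let ?g = "h(a := B)"
  have "xor_sketch ?g D \<noteq> {}" if D: "D \<subseteq> insert a A" "D \<noteq> {}" "card D \<le> t" for D
  proof (cases "a \<in> D")
    case False
    then have "xor_sketch ?g D = xor_sketch h D" by (intro xor_sketch_cong) auto
    moreover have "D \<subseteq> A" using False D by auto
    ultimately show ?thesis using D h(2) by (simp add: independent_sketch_def)
  next
    case True
    have finD: "finite D" using D(1) insert.hyps(1) finite_subset by blast
    \<comment> \<open>A zero sum over \<open>D\<close> would make \<open>B\<close> equal to the sum
      over \<open>D - {a}\<close>, a small set of old elements.\<close>
    have "xor_sketch ?g (D - {a}) = xor_sketch h (D - {a})" by (intro xor_sketch_cong) auto
    moreover have "D = sym_diff (D - {a}) {a}" using True by auto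
    ultimately have "xor_sketch ?g D = sym_diff (xor_sketch h (D - {a})) B"
      using xor_sketch_sym_diff[of "D - {a}" "{a}" ?g] finD
      by (simp add: xor_sketch_singleton)
    moreover have "D - {a} \<in> ?F" using D card_Diff1_le[of D a] by auto
    then have "xor_sketch h (D - {a}) \<noteq> B" using B(2) by blast
    ultimately show ?thesis by auto
  qed
  moreover have "range ?g \<subseteq> Pow I" using h(1) B(1) by auto
  ultimately show ?case unfolding independent_sketch_def by blast
qed

text \<open>List the elements of a small set and pad with \<open>None\<close> to length
  \<open>t\<close>; the set can be read off the list.\<close>

lemma card_small_subsets_le:
  assumes "finite A"
  shows "card {D. D \<subseteq> A \<and> card D \<le> t} \<le> (card A + 1) ^ t"
proof -
  let ?O = "insert None (Some ` A)"
  let ?L = "{xs. set xs \<subseteq> ?O \<and> length xs = t}"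
  have finL: "finite ?L" using assms by (intro finite_lists_length_eq) auto
  have "{D. D \<subseteq> A \<and> card D \<le> t} \<subseteq> (\<lambda>xs. {a. Some a \<in> set xs}) ` ?L"
  proof clarify
    fix D assume D: "D \<subseteq> A" "card D \<le> t"
    obtain ys where ys: "set ys = D" "distinct ys"
      using D(1) assms finite_subset finite_distinct_list by metis
    let ?xs = "map Some ys @ replicate (t - card D) None"
    have "?xs \<in> ?L" "D = {a. Some a \<in> set ?xs}"
      using ys D by (auto simp: distinct_card[symmetric])
    then show "D \<in> (\<lambda>xs. {a. Some a \<in> set xs}) ` ?L" by blast
  qed
  then have "card {D. D \<subseteq> A \<and> card D \<le> t} \<le> card ((\<lambda>xs. {a. Some a \<in> set xs}) ` ?L)"
    using finL by (intro card_mono) auto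
  also have "\<dots> \<le> card ?L" using finL by (rule card_image_le)
  also have "\<dots> = card ?O ^ t" using assms by (intro card_lists_length_eq) auto
  also have "card ?O = card A + 1" using assms by (simp add: card_image)
  finally show ?thesis .
qed

text \<open>By linearity the symmetric difference has zero sum, and it has at most
  \<open>2 * s\<close> elements.\<close>

lemma xor_sketch_inject:
  assumes "independent_sketch h A (2 * s)" "finite A"
    and "D \<subseteq> A" "D' \<subseteq> A" "card D \<le> s" "card D' \<le> s" "xor_sketch h D = xor_sketch h D'"
  shows "D = D'"
proof (rule ccontr)
  assume "D \<noteq> D'"
  have fin: "finite D" "finite D'" using assms finite_subset by blast+
  have "card (sym_diff D D') \<le> card (D \<union> D')" using fin by (intro card_mono) auto
  also have "\<dots> \<le> 2 * s" using card_Un_le[of D D'] assms by simp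
  finally have "card (sym_diff D D') \<le> 2 * s" .
  moreover have "sym_diff D D' \<noteq> {}" "sym_diff D D' \<subseteq> A"
    using \<open>D \<noteq> D'\<close> assms by auto
  ultimately have "xor_sketch h (sym_diff D D') \<noteq> {}"
    using assms(1) by (simp add: independent_sketch_def)
  then show False using xor_sketch_sym_diff[OF fin, of h] assms by simp
qed

section \<open>Insertion-deletion streams\<close>

text \<open>With \<open>t = 2 * ((k + 1) * n)\<close>, the small edge sets number at most
  \<open>(n * n + 1) ^ t\<close>. The first factor is a bit count for \<open>n * n + 1\<close>; the
  final 1 makes the inequality strict.\<close>

definition sketch_dim :: "nat \<Rightarrow> nat \<Rightarrow> nat" where
  "sketch_dim n k = (2 * nat \<lceil>log 2 (real n)\<rceil> + 1) * (2 * ((k + 1) * n)) + 1"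

text \<open>The choice depends on \<open>n\<close> and \<open>k\<close> only, so the algorithm is
  deterministic and needs no memory for the vectors.\<close>

definition edge_vector :: "nat \<Rightarrow> nat \<Rightarrow> nat set \<Rightarrow> nat set" where
  "edge_vector n k = (SOME h. range h \<subseteq> Pow {..<sketch_dim n k} \<and>
     independent_sketch h (all_edges {..<n}) (2 * ((k + 1) * n)))"

lemma edge_vector:
  "range (edge_vector n k) \<subseteq> Pow {..<sketch_dim n k}"
  "independent_sketch (edge_vector n k) (all_edges {..<n}) (2 * ((k + 1) * n))"
proof -
  let ?t = "2 * ((k + 1) * n)" and ?L = "nat \<lceil>log 2 (real n)\<rceil>" and ?A = "all_edges {..<n}"
  have fin: "finite ?A" by (simp add: finite_all_edges)
  have "card ?A \<le> 2 ^ (2 * ?L)"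
    using card_all_edges_le[of "{..<n}"] square_le_two_power_log[of n] by simp
  then have "card ?A + 1 \<le> 2 ^ (2 * ?L) + 2 ^ (2 * ?L)" by (intro add_mono) simp_all
  then have "card ?A + 1 \<le> 2 ^ (2 * ?L + 1)" by simp
  then have "(card ?A + 1) ^ ?t \<le> (2 ^ (2 * ?L + 1)) ^ ?t" by (rule power_mono) simp
  also have "\<dots> = 2 ^ ((2 * ?L + 1) * ?t)" by (rule power_mult[symmetric])
  also have "\<dots> < 2 ^ sketch_dim n k" by (simp add: sketch_dim_def)
  finally have "card {D. D \<subseteq> ?A \<and> card D \<le> ?t} < 2 ^ card {..<sketch_dim n k}"
    using card_small_subsets_le[OF fin, of ?t] by simp
  from someI_ex[OF ex_independent_sketch[OF fin _ this]]
  show "range (edge_vector n k) \<subseteq> Pow {..<sketch_dim n k}"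
    "independent_sketch (edge_vector n k) ?A ?t"
    unfolding edge_vector_def by auto
qed

text \<open>The head is the edge counter. Each coordinate occupies a word of its own, which the
  polylogarithmic factor permits.\<close>

definition encode_sketch :: "nat \<Rightarrow> nat \<Rightarrow> nat set \<Rightarrow> nat list" where
  "encode_sketch N c S = c # map (\<lambda>i. of_bool (i \<in> S)) [0..<N]"

definition sketch_support :: "nat list \<Rightarrow> nat set" where
  "sketch_support m = {i. i < length (tl m) \<and> tl m ! i = 1}"

lemma sketch_support_encode_sketch:
  "S \<subseteq> {..<N} \<Longrightarrow> sketch_support (encode_sketch N c S) = S"
  by (auto simp: sketch_support_def encode_sketch_def of_bool_def split: if_splits)

definition graph_sketch :: "nat \<Rightarrow> nat \<Rightarrow> nat set set \<Rightarrow> nat list" where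
  "graph_sketch n k E = encode_sketch (sketch_dim n k) (card E) (xor_sketch (edge_vector n k) E)"

text \<open>Addition is its own inverse here, so insertion and deletion differ only in the counter.
  The decision searches all sparse graphs for one that matches the memory.\<close>

definition sketch_edges :: graph_algorithm where
  "sketch_edges n k =
    \<lparr>init = graph_sketch n k {},
     step = (\<lambda>m u. case u of
         Insert e \<Rightarrow> encode_sketch (sketch_dim n k) (hd m + 1)
           (sym_diff (sketch_support m) (edge_vector n k e))
       | Delete e \<Rightarrow> encode_sketch (sketch_dim n k) (hd m - 1)
           (sym_diff (sketch_support m) (edge_vector n k e))),
     decision = (\<lambda>m. \<exists>E\<subseteq>all_edges {..<n}. card E \<le> (k + 1) * n \<and>
       graph_sketch n k E = m \<and> has_FVS k {..<n} E)\<rparr>"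

lemma xor_sketch_edge_vector_subset:
  "xor_sketch (edge_vector n k) E \<subseteq> {..<sketch_dim n k}"
proof
  fix i assume "i \<in> xor_sketch (edge_vector n k) E"
  then have "{e \<in> E. i \<in> edge_vector n k e} \<noteq> {}"
    by (auto simp: xor_sketch_def simp del: Collect_empty_eq)
  then show "i \<in> {..<sketch_dim n k}" using edge_vector(1)[of n k] by auto
qed

lemma hd_graph_sketch: "hd (graph_sketch n k E) = card E"
  by (simp add: graph_sketch_def encode_sketch_def)

lemma sketch_support_graph_sketch:
  "sketch_support (graph_sketch n k E) = xor_sketch (edge_vector n k) E"
  by (simp add: graph_sketch_def sketch_support_encode_sketch xor_sketch_edge_vector_subset)

text \<open>Sparsity is assumed of \<open>E\<close> alone. The edge counter transfers it to
  \<open>F\<close>; without it, a dense graph might share the sum of a sparse one.\<close>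

lemma graph_sketch_inject:
  assumes "E \<subseteq> all_edges {..<n}" "F \<subseteq> all_edges {..<n}" "card E \<le> (k + 1) * n"
    and eq: "graph_sketch n k E = graph_sketch n k F"
  shows "E = F"
proof (rule xor_sketch_inject[OF edge_vector(2)[of n k]])
  show "card F \<le> (k + 1) * n"
    using assms(3) arg_cong[OF eq, of hd] by (simp add: hd_graph_sketch)
  show "xor_sketch (edge_vector n k) E = xor_sketch (edge_vector n k) F"
    using arg_cong[OF eq, of sketch_support] by (simp add: sketch_support_graph_sketch)
qed (use assms finite_all_edges in auto)

text \<open>Validity makes either kind of update the symmetric difference with \<open>{e}\<close>
  and keeps the counter exact.\<close>

lemma step_sketch_edges:
  assumes "finite E" "valid_update V E u"
  shows "step (sketch_edges n k) (graph_sketch n k E) u = graph_sketch n k (apply_update E u)"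
proof -
  have xor: "xor_sketch (edge_vector n k) (sym_diff E {e}) =
      sym_diff (xor_sketch (edge_vector n k) E) (edge_vector n k e)" for e
    using xor_sketch_sym_diff[OF assms(1), of "{e}"] by (simp add: xor_sketch_singleton)
  show ?thesis
  proof (cases u)
    case (Insert e)
    then have e: "e \<notin> E" using assms(2) by simp
    then have "sym_diff E {e} = insert e E" by auto
    then show ?thesis using xor[of e] e assms(1) Insert
      by (simp add: sketch_edges_def hd_graph_sketch sketch_support_graph_sketch)
        (simp add: graph_sketch_def)
  next
    case (Delete e)
    then have e: "e \<in> E" using assms(2) by simp
    then have "sym_diff E {e} = E - {e}" by auto
    then show ?thesis using xor[of e] e assms(1) Delete
      by (simp add: sketch_edges_def hd_graph_sketch sketch_support_graph_sketch)
        (simp add: graph_sketch_def)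
  qed
qed

lemma memory_sketch_edges:
  "us \<in> insertion_deletion_streams n \<Longrightarrow>
     memory (sketch_edges n k) us = graph_sketch n k (stream_graph us)"
proof (induction us rule: rev_induct)
  case Nil
  then show ?case by (simp add: memory_def sketch_edges_def stream_graph_def)
next
  case (snoc u us)
  then have "us \<in> insertion_deletion_streams n" "valid_update {..<n} (stream_graph us) u"
    by (auto simp: insertion_deletion_streams_snoc)
  then show ?case
    using snoc.IH step_sketch_edges[OF finite_stream_graph]
    by (simp add: memory_snoc stream_graph_snoc)
qed

lemma solves_FVS_sketch_edges: "solves_FVS sketch_edges insertion_deletion_streams"
  unfolding solves_FVS_def
proof (intro allI ballI)
  fix n k us assume us: "us \<in> insertion_deletion_streams n"
  let ?E = "stream_graph us"
  have sub: "?E \<subseteq> all_edges {..<n}" using us by (rule stream_graph_subset)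
  have "decision (sketch_edges n k) (memory (sketch_edges n k) us) \<longleftrightarrow>
      (\<exists>E\<subseteq>all_edges {..<n}. card E \<le> (k + 1) * n \<and>
        graph_sketch n k E = graph_sketch n k ?E \<and> has_FVS k {..<n} E)"
    unfolding memory_sketch_edges[OF us] by (simp add: sketch_edges_def)
  \<comment> \<open>By injectivity, a sparse graph that matches the memory is the streamed graph
    itself.\<close>
  also have "\<dots> \<longleftrightarrow> card ?E \<le> (k + 1) * n \<and> has_FVS k {..<n} ?E"
    using graph_sketch_inject[OF _ sub] sub by blast
  also have "\<dots> \<longleftrightarrow> has_FVS k {..<n} ?E"
    using card_le_if_has_FVS[OF _ sub] by auto
  finally show "decision (sketch_edges n k) (memory (sketch_edges n k) us) \<longleftrightarrow>
    has_FVS k {..<n} ?E" .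
qed

lemma uses_space_sketch_edges:
  "uses_space sketch_edges insertion_deletion_streams
     (\<lambda>n k. 22 * (real k * real n) * log 2 (real n) ^ 1)"
  unfolding uses_space_def
proof (intro exI[of _ 3] allI impI ballI conjI)
  fix n k :: nat and us
  assume nk: "2 \<le> n" "1 \<le> k" and us: "us \<in> insertion_deletion_streams n"
  let ?L = "nat \<lceil>log 2 (real n)\<rceil>" and ?l = "log 2 (real n)"
  have l: "1 \<le> ?l" using nk by (simp add: le_log_iff)
  have "real ?L = of_int \<lceil>?l\<rceil>" using l by simp
  then have L: "real ?L \<le> 2 * ?l"
    using l of_int_ceiling_le_add_one[of ?l] by linarith
  define Q where "Q = real k * real n"
  have n_le: "real n \<le> Q" and kn: "1 \<le> Q"
  proof -
    show "real n \<le> Q" using nk by (simp add: Q_def)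
    then show "1 \<le> Q" using nk by linarith
  qed
  have "real (length (memory (sketch_edges n k) us)) = real (sketch_dim n k + 1)"
    by (simp add: memory_sketch_edges[OF us] graph_sketch_def encode_sketch_def)
  also have "\<dots> = (2 * real ?L + 1) * (2 * (Q + real n)) + 2"
    by (simp add: sketch_dim_def Q_def algebra_simps)
  \<comment> \<open>As \<open>?l \<ge> 1\<close>, rounding up at most doubles it, so
    \<open>2 * ?L + 1\<close> is at most \<open>5 * ?l\<close>. The summand 2 is the counter word
    plus the final 1 of \<open>sketch_dim\<close>. In total, 20 + 2 = 22.\<close>
  also have "\<dots> \<le> (5 * ?l) * (4 * Q) + 2 * (?l * Q)"
  proof (rule add_mono)
    show "(2 * real ?L + 1) * (2 * (Q + real n))
        \<le> (5 * ?l) * (4 * Q)"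
    proof (rule mult_mono)
      show "2 * real ?L + 1 \<le> 5 * ?l" using l L by linarith
      show "2 * (Q + real n) \<le> 4 * Q" using n_le by simp
    qed (use l kn in simp_all)
    show "2 \<le> 2 * (?l * Q)" using mult_mono[OF l kn] l by simp
  qed
  finally show "real (length (memory (sketch_edges n k) us))
    \<le> 22 * (real k * real n) * ?l ^ 1" by (simp add: Q_def algebra_simps)
  fix w assume "w \<in> set (memory (sketch_edges n k) us)"
  then have "w = card (stream_graph us) \<or> w \<le> 1"
    by (auto simp: memory_sketch_edges[OF us] graph_sketch_def encode_sketch_def)
  moreover have "card (stream_graph us) \<le> 2 ^ (2 * ?L)"
    using card_mono[OF finite_all_edges stream_graph_subset[OF us]]
      card_all_edges_le[of "{..<n}"] square_le_two_power_log[of n] by simp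
  moreover have "(1::nat) \<le> 2 ^ (2 * ?L)" by simp
  ultimately have "w \<le> 2 ^ (2 * ?L)" by (elim disjE) linarith+
  \<comment> \<open>The edge count is bounded only non-strictly by \<open>2 ^ (2 * ?L)\<close>; a
    third multiple of \<open>?L\<close>, which is positive, gives strictness.\<close>
  also have "(2::nat) ^ (2 * ?L) < 2 ^ (3 * ?L)"
    using l by (intro power_strict_increasing) auto
  finally show "w < 2 ^ (3 * ?L)" .
qed

theorem theorem27:
  shows "(\<exists>(A :: graph_algorithm) (C :: real).
            solves_FVS A insertion_only_streams \<and>
            uses_space A insertion_only_streams (\<lambda>n k. C * (real k * real n))) \<and>
         (\<exists>(A :: graph_algorithm) (C :: real) (c :: nat).
            solves_FVS A insertion_deletion_streams \<and>
            uses_space A insertion_deletion_streams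
              (\<lambda>n k. C * (real k * real n) * log 2 (real n) ^ c))"
proof (rule conjI)
  show "\<exists>A C. solves_FVS A insertion_only_streams \<and>
      uses_space A insertion_only_streams (\<lambda>n k. C * (real k * real n))"
    using solves_FVS_store_edges uses_space_store_edges by (intro exI conjI)
  show "\<exists>A C c. solves_FVS A insertion_deletion_streams \<and>
      uses_space A insertion_deletion_streams
        (\<lambda>n k. C * (real k * real n) * log 2 (real n) ^ c)"
    using solves_FVS_sketch_edges uses_space_sketch_edges by (intro exI conjI)
qed

end
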